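(* If $G$ is an HOH-free multisun, then $G$ satisfies the N-conditions.
   Context: A multisun is a graph with no induced $K_4$ minus an edge, of odd order, whose maximal cliques of size $2$ form the edge set of a Hamiltonian cycle $C$ (the rim); all other maximal cliques consist of pairwise nonconsecutive vertices of $C$ and are called inscribed cliques. A sub-multisun of $G$ is obtained by deleting the edge sets of some, but not all, inscribed cliques. $G$ is HOH-free if neither $G$ nor any sub-multisun contains an odd hole (induced cycle of odd length $\ge5$) as an induced subgraph. For inscribed cliques $A,B$ (not necessarily distinct), an $AB$-path is a subpath of $C$ with one endpoint in $A$ and the other in $B$ whose internal vertices lie in no inscribed clique; an $A$-path is an $AA$-path; for $v\in B$, an $Av$-path is an $AB$-path whose endpoint in $B$ is $v$. The N-conditions: (N1) for each inscribed clique $A$, every $A$-path has an even number of vertices, at least four; (N2) every inscribed clique has odd size; (N3) all inscribed cliques contain a common vertex $\xi\in V(C)$ and are pairwise disjoint apart from $\xi$; (N4) if $P$ is an $A\xi$-path for some inscribed clique $A$, then $P$ has an even number of vertices; (N5) if $P$ is an $AB$-path for distinct inscribed cliques $A,B$, then $P$ has an odd number of vertices.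
   Formalization: In (N5), only AB-paths with one endpoint in A−B and the other in B−A (so not ending at ξ) are considered; an AB-path ending at ξ is also an A-path or a B-path and has an even number of vertices by (N1), so (N5) taken literally fails. *)

theory Defs
  imports Main
begin

definition simple_graph :: "'a set \<Rightarrow> 'a set set \<Rightarrow> bool" where
  "simple_graph V E \<longleftrightarrow> finite V \<and> (\<forall>e\<in>E. e \<subseteq> V \<and> card e = 2)"

definition is_clique :: "'a set \<Rightarrow> 'a set set \<Rightarrow> 'a set \<Rightarrow> bool" where
  "is_clique V E K \<longleftrightarrow> K \<subseteq> V \<and> (\<forall>x\<in>K. \<forall>y\<in>K. x \<noteq> y \<longrightarrow> {x, y} \<in> E)"

definition maximal_clique :: "'a set \<Rightarrow> 'a set set \<Rightarrow> 'a set \<Rightarrow> bool" where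
  "maximal_clique V E K \<longleftrightarrow> K \<noteq> {} \<and> is_clique V E K \<and>
     (\<forall>K'. is_clique V E K' \<and> K \<subseteq> K' \<longrightarrow> K' = K)"

definition clique_edges :: "'a set \<Rightarrow> 'a set set" where
  "clique_edges K = {{x, y} | x y. x \<in> K \<and> y \<in> K \<and> x \<noteq> y}"

definition has_induced_diamond :: "'a set \<Rightarrow> 'a set set \<Rightarrow> bool" where
  "has_induced_diamond V E \<longleftrightarrow> (\<exists>a b c d. a \<in> V \<and> b \<in> V \<and> c \<in> V \<and> d \<in> V \<and>
     distinct [a, b, c, d] \<and> {a, b} \<in> E \<and> {a, c} \<in> E \<and> {a, d} \<in> E \<and>
     {b, c} \<in> E \<and> {b, d} \<in> E \<and> {c, d} \<notin> E)"

definition cycle_edges :: "'a list \<Rightarrow> 'a set set" where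
  "cycle_edges cs = {{cs ! i, cs ! ((i + 1) mod length cs)} | i. i < length cs}"

definition is_hamiltonian_cycle_edges :: "'a set \<Rightarrow> 'a set set \<Rightarrow> bool" where
  "is_hamiltonian_cycle_edges V R \<longleftrightarrow> (\<exists>cs. distinct cs \<and> set cs = V \<and>
     length cs \<ge> 3 \<and> cycle_edges cs = R)"

definition rim :: "'a set \<Rightarrow> 'a set set \<Rightarrow> 'a set set" where
  "rim V E = {K. maximal_clique V E K \<and> card K = 2}"

definition inscribed :: "'a set \<Rightarrow> 'a set set \<Rightarrow> 'a set set" where
  "inscribed V E = {K. maximal_clique V E K \<and> card K \<noteq> 2}"

definition multisun :: "'a set \<Rightarrow> 'a set set \<Rightarrow> bool" where
  "multisun V E \<longleftrightarrow> simple_graph V E \<and> \<not> has_induced_diamond V E \<and> odd (card V) \<and>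
     is_hamiltonian_cycle_edges V (rim V E) \<and>
     (\<forall>K\<in>inscribed V E. \<forall>x\<in>K. \<forall>y\<in>K. x \<noteq> y \<longrightarrow> {x, y} \<notin> rim V E)"

definition has_odd_hole :: "'a set \<Rightarrow> 'a set set \<Rightarrow> bool" where
  "has_odd_hole V E \<longleftrightarrow> (\<exists>vs. distinct vs \<and> set vs \<subseteq> V \<and> length vs \<ge> 5 \<and>
     odd (length vs) \<and>
     (\<forall>i < length vs. \<forall>j < length vs. i \<noteq> j \<longrightarrow>
        ({vs ! i, vs ! j} \<in> E \<longleftrightarrow>
          j = (i + 1) mod length vs \<or> i = (j + 1) mod length vs)))"

definition sub_multisun_edges :: "'a set \<Rightarrow> 'a set set \<Rightarrow> 'a set set \<Rightarrow> bool" where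
  "sub_multisun_edges V E E' \<longleftrightarrow> (\<exists>S. S \<noteq> {} \<and> S \<subseteq> inscribed V E \<and> S \<noteq> inscribed V E \<and>
     E' = E - \<Union> (clique_edges ` S))"

definition HOH_free :: "'a set \<Rightarrow> 'a set set \<Rightarrow> bool" where
  "HOH_free V E \<longleftrightarrow> \<not> has_odd_hole V E \<and>
     (\<forall>E'. sub_multisun_edges V E E' \<longrightarrow> \<not> has_odd_hole V E')"

definition rim_subpath :: "'a set \<Rightarrow> 'a set set \<Rightarrow> 'a list \<Rightarrow> bool" where
  "rim_subpath V E P \<longleftrightarrow> distinct P \<and> length P \<ge> 2 \<and>
     (\<forall>i. Suc i < length P \<longrightarrow> {P ! i, P ! Suc i} \<in> rim V E)"

definition AB_path :: "'a set \<Rightarrow> 'a set set \<Rightarrow> 'a set \<Rightarrow> 'a set \<Rightarrow> 'a list \<Rightarrow> bool" where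
  "AB_path V E A B P \<longleftrightarrow> rim_subpath V E P \<and>
     ((hd P \<in> A \<and> last P \<in> B) \<or> (hd P \<in> B \<and> last P \<in> A)) \<and>
     (\<forall>v \<in> set (butlast (tl P)). v \<notin> \<Union> (inscribed V E))"

definition N1 :: "'a set \<Rightarrow> 'a set set \<Rightarrow> bool" where
  "N1 V E \<longleftrightarrow> (\<forall>A\<in>inscribed V E. \<forall>P. AB_path V E A A P \<longrightarrow>
     even (length P) \<and> length P \<ge> 4)"

definition N2 :: "'a set \<Rightarrow> 'a set set \<Rightarrow> bool" where
  "N2 V E \<longleftrightarrow> (\<forall>A\<in>inscribed V E. odd (card A))"

definition N3 :: "'a set \<Rightarrow> 'a set set \<Rightarrow> 'a \<Rightarrow> bool" where
  "N3 V E \<xi> \<longleftrightarrow> \<xi> \<in> V \<and> (\<forall>A\<in>inscribed V E. \<xi> \<in> A) \<and>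
     (\<forall>A\<in>inscribed V E. \<forall>B\<in>inscribed V E. A \<noteq> B \<longrightarrow> A \<inter> B = {\<xi>})"

text \<open>A-xi-path: AB-path (B any inscribed clique, all contain xi) whose endpoint in B is xi.\<close>
definition N4 :: "'a set \<Rightarrow> 'a set set \<Rightarrow> 'a \<Rightarrow> bool" where
  "N4 V E \<xi> \<longleftrightarrow> (\<forall>A\<in>inscribed V E. \<forall>P. AB_path V E A {\<xi>} P \<longrightarrow> even (length P))"

definition N5 :: "'a set \<Rightarrow> 'a set set \<Rightarrow> bool" where
  "N5 V E \<longleftrightarrow> (\<forall>A\<in>inscribed V E. \<forall>B\<in>inscribed V E. A \<noteq> B \<longrightarrow>
     (\<forall>P. AB_path V E (A - B) (B - A) P \<longrightarrow> odd (length P)))"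

definition N_conditions :: "'a set \<Rightarrow> 'a set set \<Rightarrow> bool" where
  "N_conditions V E \<longleftrightarrow> N1 V E \<and> N2 V E \<and>
     (\<exists>\<xi>. N3 V E \<xi> \<and> N4 V E \<xi>) \<and> N5 V E"

end

theory Submission
  imports Defs
begin

text \<open>
  Two inscribed cliques share at most one vertex, so deleting all inscribed cliques but A and B leaves
  the rim together with the edges of A and B, and this graph has no odd hole (A = B is allowed).
  With A = B, the holes formed by a chord and the rim arc between two consecutive vertices of A show
  that every such arc has an odd number of edges; as the rim is odd, so is the size of A. If A and B
  meet in \<open>\<xi>\<close>, then an AB-path closed through \<open>\<xi>\<close> is a hole, which gives N5.

  It remains to see that A and B meet; the Helly property of pairwise intersecting inscribed cliques
  (from diamond-freeness) then yields a common vertex. If A and B were disjoint, then any two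
  disjoint AB-paths not joined by a rim edge would close up to a hole through one chord of A and one
  of B, so their lengths have the same parity. On the other hand, if a single vertex of B lies
  between two consecutive vertices of A, then the two AB-paths meeting there have different parity.
  Comparing these facts, such a singleton forces the next run to be a singleton too, hence the
  vertices of A and B alternate around the rim, which is contradictory. Without singletons, all the
  places where the labels switch from A to B have rim positions of the same parity, which
  contradicts that the rim is odd.
\<close>

section \<open>Odd holes and maximal cliques in a general graph\<close>

text \<open>By symmetry ordered pairs suffice; the only cyclic neighbours with non-successive
  indices are 0 and \<open>L - 1\<close>, so \<open>mod\<close> disappears.\<close>

lemma has_odd_holeI:
  assumes "inj_on f {..<L}" "f ` {..<L} \<subseteq> V" "5 \<le> L" "odd L"
    and adj: "\<And>x y. x < y \<Longrightarrow> y < L \<Longrightarrow> {f x, f y} \<in> E \<longleftrightarrow> y = Suc x \<or> (x = 0 \<and> Suc y = L)"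
  shows "has_odd_hole V E"
proof -
  have *: "{f x, f y} \<in> E \<longleftrightarrow> y = (x + 1) mod L \<or> x = (y + 1) mod L"
    if "x < L" "y < L" "x < y" for x y
    using adj[OF that(3,2)] that assms(3) by (cases "Suc y = L") auto
  have **: "{f x, f y} \<in> E \<longleftrightarrow> y = (x + 1) mod L \<or> x = (y + 1) mod L"
    if "x < L" "y < L" "x \<noteq> y" for x y
  proof (cases "x < y")
    case True
    then show ?thesis using * that by blast
  next
    case False
    then show ?thesis using *[of y x] that by (metis insert_commute linorder_neqE_nat)
  qed
  show ?thesis
    unfolding has_odd_hole_def
    by (rule exI[of _ "map f [0..<L]"]) (use assms ** in \<open>auto simp: distinct_map atLeast0LessThan\<close>)
qed

lemma clique_edges_iff: "{x, y} \<in> clique_edges K \<longleftrightarrow> x \<in> K \<and> y \<in> K \<and> x \<noteq> y"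
  unfolding clique_edges_def by (auto simp: doubleton_eq_iff)

lemma maximal_clique_extends:
  assumes "finite V" "is_clique V E K" "K \<noteq> {}"
  shows "\<exists>M. maximal_clique V E M \<and> K \<subseteq> M"
proof -
  let ?S = "{M. is_clique V E M \<and> K \<subseteq> M}"
  have "?S \<subseteq> Pow V" by (auto simp: is_clique_def)
  then have "finite ?S" using assms(1) by (meson finite_Pow_iff finite_subset)
  moreover have "K \<in> ?S" using assms by auto
  ultimately obtain M where M: "M \<in> ?S" "\<forall>M'\<in>?S. M \<subseteq> M' \<longrightarrow> M = M'"
    using finite_has_maximal2[of ?S K] by metis
  then have "M' = M" if "is_clique V E M'" "M \<subseteq> M'" for M'
    using that by auto
  then have "maximal_clique V E M"
    using M(1) assms(3) by (auto simp: maximal_clique_def)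
  then show ?thesis using M(1) by auto
qed

text \<open>Rim vertices are enumerated with period \<open>n\<close>, so arcs are intervals of positions that may
  wrap around without modular arithmetic.\<close>
locale hoh_free_multisun =
  fixes V :: "'a set" and E :: "'a set set" and n :: nat and c :: "nat \<Rightarrow> 'a"
  assumes multi: "multisun V E" and hoh: "HOH_free V E"
    and n_ge: "3 \<le> n" and odd_n: "odd n"
    and c_eq_iff: "c i = c j \<longleftrightarrow> i mod n = j mod n"
    and range_c: "range c = V"
    and rim_eq: "rim V E = {{c i, c (Suc i)} | i. True}"
begin

section \<open>Positions on the rim\<close>

lemma finite_V: "finite V" and edge_card: "e \<in> E \<Longrightarrow> card e = 2" and edge_sub: "e \<in> E \<Longrightarrow> e \<subseteq> V"
  using multi by (auto simp: multisun_def simple_graph_def)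

lemma edge_neq: "{x, y} \<in> E \<Longrightarrow> x \<noteq> y"
  using edge_card[of "{x, y}"] by auto

lemma c_in_V [simp]: "c i \<in> V"
  using range_c by auto

lemma c_add_n [simp]: "c (i + n) = c i"
  by (simp add: c_eq_iff)

lemma c_eq_window:
  assumes "c p = c q" "m \<le> p" "p < m + n" "m \<le> q" "q < m + n"
  shows "p = q"
proof -
  have *: "a = b" if "a mod n = b mod n" "a \<le> b" "b < a + n" for a b
  proof -
    have "n dvd b - a" using that mod_eq_dvd_iff_nat by metis
    then show ?thesis using that by (auto dest: dvd_imp_le)
  qed
  show ?thesis using *[of p q] *[of q p] assms by (auto simp: c_eq_iff intro: linorder_le_cases)
qed

lemma ex_position:
  assumes "v \<in> V"
  shows "\<exists>p. m \<le> p \<and> p < m + n \<and> c p = v"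
proof -
  obtain i where i: "v = c i" using assms range_c by auto
  have "\<exists>p. m \<le> p \<and> p < m + n \<and> p mod n = i mod n"
  proof (intro exI conjI)
    \<comment> \<open>The offset from \<open>m\<close> is the residue of \<open>i - m\<close>,
      written with \<open>n - m mod n\<close> to avoid truncated subtraction.\<close>
    let ?p = "m + (i + (n - m mod n)) mod n"
    have "n > 0" using n_ge by simp
    then show "m \<le> ?p" "?p < m + n" by auto
    have "?p mod n = (m mod n + (i + (n - m mod n))) mod n" by (simp add: mod_simps)
    also have "m mod n + (i + (n - m mod n)) = i + n" using \<open>n > 0\<close> mod_less_divisor[of n m] by linarith
    finally show "?p mod n = i mod n" by simp
  qed
  then show ?thesis using i c_eq_iff by metis
qed

lemma rim_iff:
  assumes "p < q" "q < p + n"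
  shows "{c p, c q} \<in> rim V E \<longleftrightarrow> q = Suc p \<or> Suc q = p + n"
proof
  assume "{c p, c q} \<in> rim V E"
  then obtain i where i: "{c p, c q} = {c i, c (Suc i)}" using rim_eq by auto
  have S: "c a = c b \<Longrightarrow> c (Suc a) = c (Suc b)" for a b
    by (simp add: c_eq_iff) (metis mod_Suc_eq)
  from i consider "c p = c i" "c q = c (Suc i)" | "c q = c i" "c p = c (Suc i)"
    by (auto simp: doubleton_eq_iff)
  then show "q = Suc p \<or> Suc q = p + n"
  proof cases
    case 1
    then have "c q = c (Suc p)" using S by metis
    then show ?thesis using c_eq_window[of q "Suc p" p] assms n_ge by auto
  next
    case 2
    then have "c (p + n) = c (Suc q)" using S by (metis c_add_n)
    then show ?thesis using c_eq_window[of "p + n" "Suc q" "Suc p"] assms n_ge by auto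
  qed
next
  assume "q = Suc p \<or> Suc q = p + n"
  then show "{c p, c q} \<in> rim V E"
  proof
    assume "Suc q = p + n"
    then have "c p = c (Suc q)" by simp
    then show ?thesis using rim_eq by (auto simp: insert_commute)
  qed (use rim_eq in auto)
qed

lemma rim_Suc: "{c p, c (Suc p)} \<in> rim V E"
  using rim_eq by auto

lemma rim_sub_E: "rim V E \<subseteq> E"
proof
  fix e assume e: "e \<in> rim V E"
  then obtain i where i: "e = {c i, c (Suc i)}" using rim_eq by auto
  have "card e = 2" using e by (auto simp: rim_def)
  then have "c i \<noteq> c (Suc i)" using i by auto
  then show "e \<in> E" using e i by (auto simp: rim_def maximal_clique_def is_clique_def)
qed

section \<open>Inscribed cliques and diamond-freeness\<close>

text \<open>A common neighbour of both ends would extend the rim edge, which is a maximal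
  clique.\<close>

lemma rim_triangle_free:
  assumes "{c p, x} \<in> E" "{c (Suc p), x} \<in> E"
  shows False
proof -
  have "maximal_clique V E {c p, c (Suc p)}" using rim_Suc by (auto simp: rim_def)
  moreover have "is_clique V E {c p, c (Suc p), x}"
    using assms rim_Suc rim_sub_E edge_sub by (auto simp: is_clique_def insert_commute)
  ultimately have "{c p, c (Suc p), x} = {c p, c (Suc p)}" 
    unfolding maximal_clique_def by blast
  then have "x = c p \<or> x = c (Suc p)" by auto
  then show False using edge_neq assms by blast
qed

lemma inscribed_edge: "A \<in> inscribed V E \<Longrightarrow> x \<in> A \<Longrightarrow> y \<in> A \<Longrightarrow> x \<noteq> y \<Longrightarrow> {x, y} \<in> E"
  by (auto simp: inscribed_def maximal_clique_def is_clique_def)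

lemma inscribed_sub_V: "A \<in> inscribed V E \<Longrightarrow> A \<subseteq> V"
  by (auto simp: inscribed_def maximal_clique_def is_clique_def)

lemma inscribed_not_rim:
  "A \<in> inscribed V E \<Longrightarrow> x \<in> A \<Longrightarrow> y \<in> A \<Longrightarrow> {x, y} \<notin> rim V E"
  using multi by (cases "x = y") (auto simp: multisun_def rim_def)

lemma inscribed_Suc: "A \<in> inscribed V E \<Longrightarrow> c p \<in> A \<Longrightarrow> c (Suc p) \<notin> A"
  using inscribed_not_rim rim_Suc by blast

text \<open>A chord spanning two rim edges would complete a triangle on a rim edge.\<close>

lemma inscribed_Suc_Suc:
  assumes "A \<in> inscribed V E" "c p \<in> A"
  shows "c (Suc (Suc p)) \<notin> A"
proof
  assume "c (Suc (Suc p)) \<in> A"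
  moreover have "c p \<noteq> c (Suc (Suc p))"
    using c_eq_window[of p "Suc (Suc p)" p] n_ge by auto
  ultimately have "{c p, c (Suc (Suc p))} \<in> E" using assms inscribed_edge by blast
  then show False using rim_triangle_free rim_Suc rim_sub_E by blast
qed

lemma inscribed_card_ge:
  assumes A: "A \<in> inscribed V E"
  shows "3 \<le> card A"
proof -
  have "A \<noteq> {}" "card A \<noteq> 2" using A by (auto simp: inscribed_def maximal_clique_def)
  moreover have "finite A" using inscribed_sub_V[OF A] finite_V finite_subset by blast
  \<comment> \<open>A single vertex is never a maximal clique, as it lies on a rim edge.\<close>
  moreover have "card A \<noteq> 1"
  proof
    assume "card A = 1"
    then obtain x where x: "A = {x}" by (auto simp: card_1_singleton_iff)
    then obtain p where p: "x = c p" using inscribed_sub_V[OF A] range_c by auto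
    have "is_clique V E {c p, c (Suc p)}"
      using rim_Suc rim_sub_E by (auto simp: is_clique_def insert_commute)
    then have "{c p, c (Suc p)} = A"
      using A x p by (auto simp: inscribed_def maximal_clique_def)
    then show False using inscribed_Suc[OF A, of p] by auto
  qed
  ultimately have "card A \<noteq> 0 \<and> card A \<noteq> 1 \<and> card A \<noteq> 2" by auto
  then show ?thesis by linarith
qed

text \<open>Otherwise take \<open>a\<close> in \<open>A - B\<close> and, by maximality of
  \<open>B\<close>, some \<open>b\<close> in \<open>B\<close> not adjacent to \<open>a\<close>: with
  \<open>x\<close> and \<open>y\<close> they induce a diamond.\<close>

lemma inscribed_Int:
  assumes A: "A \<in> inscribed V E" and B: "B \<in> inscribed V E" and "A \<noteq> B"
    and x: "x \<in> A" "x \<in> B" and y: "y \<in> A" "y \<in> B"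
  shows "x = y"
proof (rule ccontr)
  assume "x \<noteq> y"
  have "\<not> A \<subseteq> B"
    using A B \<open>A \<noteq> B\<close> by (auto simp: inscribed_def maximal_clique_def)
  then obtain a where a: "a \<in> A" "a \<notin> B" by auto
  have "\<not> is_clique V E (insert a B)"
    using a B by (auto simp: inscribed_def maximal_clique_def)
  then obtain b where b: "b \<in> B" "{a, b} \<notin> E"
    using inscribed_sub_V[OF A] inscribed_sub_V[OF B] a inscribed_edge[OF B]
    unfolding is_clique_def by (auto simp: insert_commute)
  have "x \<noteq> b" "y \<noteq> b" using a b inscribed_edge[OF A] x y by (metis insert_commute)+
  then have "has_induced_diamond V E"
    unfolding has_induced_diamond_def
    using x y a b \<open>x \<noteq> y\<close> inscribed_edge[OF A] inscribed_edge[OF B] inscribed_sub_V[OF A] inscribed_sub_V[OF B]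
    by (intro exI[of _ x] exI[of _ y] exI[of _ a] exI[of _ b]) auto
  then show False using multi by (auto simp: multisun_def)
qed

text \<open>Otherwise \<open>x\<close>, \<open>y\<close>, \<open>z\<close> form a triangle with
  \<open>z\<close> outside \<open>A\<close>. Maximality of \<open>A\<close> gives \<open>w\<close>
  in \<open>A\<close> not adjacent to \<open>z\<close>, and the four vertices induce a
  diamond.\<close>

lemma inscribed_helly:
  assumes A: "A \<in> inscribed V E" and B: "B \<in> inscribed V E" and C: "C \<in> inscribed V E"
    and x: "x \<in> A" "x \<in> B" and y: "y \<in> A" "y \<in> C" and z: "z \<in> B" "z \<in> C"
    and ne: "A \<noteq> B"
  shows "x \<in> C"
proof (rule ccontr)
  assume xC: "x \<notin> C"
  then have "x \<noteq> y" "x \<noteq> z" "C \<noteq> A" "C \<noteq> B" using x y z by auto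
  have "y \<noteq> z" using \<open>x \<noteq> y\<close> inscribed_Int[OF A B ne x] y z by auto
  have zA: "z \<notin> A" using \<open>x \<noteq> z\<close> inscribed_Int[OF A B ne x] z by auto
  have "\<not> is_clique V E (insert z A)"
    using zA A by (auto simp: inscribed_def maximal_clique_def)
  then obtain w where w: "w \<in> A" "{z, w} \<notin> E"
    using inscribed_sub_V[OF A] inscribed_sub_V[OF B] z inscribed_edge[OF A]
    unfolding is_clique_def by (auto simp: insert_commute)
  have "x \<noteq> w" "y \<noteq> w"
    using w inscribed_edge[OF B] inscribed_edge[OF C] x y z \<open>x \<noteq> z\<close> \<open>y \<noteq> z\<close> by (metis)+
  then have "has_induced_diamond V E"
    unfolding has_induced_diamond_def
    using x y z w zA \<open>x \<noteq> y\<close> \<open>x \<noteq> z\<close> \<open>y \<noteq> z\<close> inscribed_edge[OF A] inscribed_edge[OF B] inscribed_edge[OF C]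
      inscribed_sub_V[OF A] inscribed_sub_V[OF B]
    by (intro exI[of _ x] exI[of _ y] exI[of _ z] exI[of _ w]) auto
  then show False using multi by (auto simp: multisun_def)
qed

lemma edge_cases:
  assumes "e \<in> E"
  shows "e \<in> rim V E \<or> (\<exists>A\<in>inscribed V E. e \<in> clique_edges A)"
proof -
  obtain x y where e: "e = {x, y}" "x \<noteq> y" using edge_card[OF assms] by (auto simp: card_2_iff)
  have "is_clique V E e" using assms e edge_sub by (auto simp: is_clique_def insert_commute)
  then obtain M where M: "maximal_clique V E M" "e \<subseteq> M"
    using maximal_clique_extends finite_V e by blast
  show ?thesis
  proof (cases "card M = 2")
    case True
    then have "finite M" using card_ge_0_finite by force
    then have "M = e" using True M edge_card[OF assms] by (metis card_subset_eq)
    then show ?thesis using M True by (auto simp: rim_def)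
  next
    case False
    then show ?thesis using M e by (auto simp: inscribed_def clique_edges_iff)
  qed
qed

section \<open>Holes in the graph formed by the rim and at most two inscribed cliques\<close>

definition two_clique_edges :: "'a set \<Rightarrow> 'a set \<Rightarrow> 'a set set" where
  "two_clique_edges A B = rim V E \<union> clique_edges A \<union> clique_edges B"

text \<open>Distinct inscribed cliques share no edge and none contains a rim edge, so deleting all
  the others leaves exactly these edges.\<close>

lemma no_odd_hole_two_cliques:
  assumes A: "A \<in> inscribed V E" and B: "B \<in> inscribed V E"
  shows "\<not> has_odd_hole V (two_clique_edges A B)"
proof -
  let ?S = "inscribed V E - {A, B}"
  have rim: "e \<notin> clique_edges K" if "e \<in> rim V E" "K \<in> inscribed V E" for e K
    using that inscribed_not_rim by (auto simp: clique_edges_def)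
  have disj: "e \<notin> clique_edges K'"
    if "e \<in> clique_edges K" "K \<in> inscribed V E" "K' \<in> inscribed V E" "K \<noteq> K'" for e K K'
  proof -
    from that(1) obtain x y where "e = {x, y}" "x \<in> K" "y \<in> K" "x \<noteq> y"
      unfolding clique_edges_def by blast
    then show ?thesis using inscribed_Int[OF that(2,3,4)] by (auto simp: clique_edges_iff)
  qed
  have sub: "clique_edges K \<subseteq> E" if "K \<in> inscribed V E" for K
    using inscribed_edge[OF that] by (auto simp: clique_edges_def)
  have eq: "two_clique_edges A B = E - \<Union> (clique_edges ` ?S)"
  proof
    show "two_clique_edges A B \<subseteq> E - \<Union> (clique_edges ` ?S)"
      using rim disj A B sub rim_sub_E unfolding two_clique_edges_def by blast
    show "E - \<Union> (clique_edges ` ?S) \<subseteq> two_clique_edges A B"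
      using edge_cases unfolding two_clique_edges_def by blast
  qed
  show ?thesis
  \<comment> \<open>A sub-multisun deletes at least one clique; with nothing to delete the graph is
    \<open>E\<close> itself.\<close>
  proof (cases "?S = {}")
    case True
    then have "two_clique_edges A B = E" unfolding eq True by simp
    then show ?thesis using hoh by (simp add: HOH_free_def)
  next
    case False
    then have "sub_multisun_edges V E (two_clique_edges A B)"
      unfolding sub_multisun_edges_def using eq A by (intro exI[of _ ?S]) auto
    then show ?thesis using hoh by (simp add: HOH_free_def)
  qed
qed

lemma two_clique_edges_iff:
  assumes "p \<noteq> q" "m \<le> p" "p < m + n" "m \<le> q" "q < m + n"
  shows "{c p, c q} \<in> two_clique_edges A B \<longleftrightarrow>
    (q = Suc p \<or> p = Suc q \<or> Suc q = p + n \<or> Suc p = q + n) \<or>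
      (c p \<in> A \<and> c q \<in> A) \<or> (c p \<in> B \<and> c q \<in> B)"
proof -
  have "c p \<noteq> c q" using c_eq_window assms by blast
  moreover have "{c p, c q} \<in> rim V E \<longleftrightarrow> q = Suc p \<or> p = Suc q \<or> Suc q = p + n \<or> Suc p = q + n"
  proof (cases "p < q")
    case True
    then show ?thesis using rim_iff[of p q] assms by auto
  next
    case False
    then have "q < p" using assms by simp
    then show ?thesis using rim_iff[of q p] assms by (auto simp: insert_commute)
  qed
  ultimately show ?thesis by (simp add: two_clique_edges_def clique_edges_iff)
qed

text \<open>The common form of all hole arguments below: \<open>g\<close> lists the positions of a
  cycle inside one window of length \<open>n\<close>, so adjacency reduces to arithmetic and
  membership in \<open>A\<close> or \<open>B\<close>.\<close>

lemma no_odd_position_hole: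
  assumes A: "A \<in> inscribed V E" and B: "B \<in> inscribed V E"
    and inj: "\<And>x y. x < y \<Longrightarrow> y < L \<Longrightarrow> g x \<noteq> g y"
    and bnd: "\<And>x. x < L \<Longrightarrow> m \<le> g x \<and> g x < m + n" and "5 \<le> L"
    and adj: "\<And>x y. x < y \<Longrightarrow> y < L \<Longrightarrow>
      ((g y = Suc (g x) \<or> g x = Suc (g y) \<or> Suc (g y) = g x + n \<or> Suc (g x) = g y + n) \<or>
      (c (g x) \<in> A \<and> c (g y) \<in> A) \<or> (c (g x) \<in> B \<and> c (g y) \<in> B))
      \<longleftrightarrow> y = Suc x \<or> (x = 0 \<and> Suc y = L)"
  shows "even L"
proof (rule ccontr)
  assume "odd L"
  have "has_odd_hole V (two_clique_edges A B)"
  proof (rule has_odd_holeI[of "\<lambda>x. c (g x)" L])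
    show "inj_on (\<lambda>x. c (g x)) {..<L}"
    proof (rule inj_onI)
      fix x y assume xy: "x \<in> {..<L}" "y \<in> {..<L}" "c (g x) = c (g y)"
      then have "g x = g y" using c_eq_window[of "g x" "g y" m] bnd by auto
      then show "x = y" using inj[of x y] inj[of y x] xy by (metis lessThan_iff linorder_neqE_nat)
    qed
    fix x y assume "x < y" "y < L"
    then show "{c (g x), c (g y)} \<in> two_clique_edges A B \<longleftrightarrow> y = Suc x \<or> (x = 0 \<and> Suc y = L)"
      using two_clique_edges_iff[of "g x" "g y" m A B] inj[of x y] bnd[of x] bnd[of y] adj[of x y]
      by simp
  qed (use \<open>odd L\<close> assms in auto)
  then show False using no_odd_hole_two_cliques[OF A B] by simp
qed

section \<open>Parity within a single inscribed clique\<close>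

text \<open>The arc and the chord joining its ends form a hole on \<open>j - i + 1\<close> vertices;
  a full turn has \<open>n\<close> edges, an odd number.\<close>

lemma consecutive_odd:
  assumes A: "A \<in> inscribed V E" and ij: "i < j" "c i \<in> A" "c j \<in> A"
    and between: "\<And>k. i < k \<Longrightarrow> k < j \<Longrightarrow> c k \<notin> A"
  shows "odd (j - i)"
proof -
  have "j \<le> i + n" using between[of "i + n"] n_ge ij by force
  show ?thesis
  proof (cases "j = i + n")
    case True
    then show ?thesis using odd_n by simp
  next
    case False
    then have j: "j < i + n" using \<open>j \<le> i + n\<close> by simp
    have "j \<noteq> Suc i" "j \<noteq> Suc (Suc i)" "Suc j \<noteq> i + n"
      using inscribed_Suc[OF A, of i] inscribed_Suc_Suc[OF A, of i] inscribed_Suc[OF A, of j] ij c_add_n[of i]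
      by metis+
    then have "j \<ge> i + 3" "Suc j < i + n" using ij j by auto
    have "even (Suc (j - i))" if "\<not> Suc (j - i) < 5"
    proof (rule no_odd_position_hole[OF A A, of _ "\<lambda>x. i + x" i])
      fix x y assume xy: "x < y" "y < Suc (j - i)"
      have "c (i + x) \<in> A \<longleftrightarrow> x = 0"
        using xy ij between[of "i + x"] by (cases "x = 0") auto
      moreover have "c (i + y) \<in> A \<longleftrightarrow> y = j - i"
        using xy ij between[of "i + y"] by (cases "y = j - i") auto
      ultimately show "((i + y = Suc (i + x) \<or> i + x = Suc (i + y) \<or> Suc (i + y) = i + x + n \<or> Suc (i + x) = i + y + n) \<or>
        (c (i + x) \<in> A \<and> c (i + y) \<in> A) \<or> (c (i + x) \<in> A \<and> c (i + y) \<in> A))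
        \<longleftrightarrow> y = Suc x \<or> (x = 0 \<and> Suc y = Suc (j - i))"
        using xy \<open>Suc j < i + n\<close> ij by auto
    qed (use that j in auto)
    \<comment> \<open>Distances 1 and 2 are excluded, so a short arc has three edges and closes to a
      4-cycle.\<close>
    moreover have "odd (j - i)" if "Suc (j - i) < 5"
    proof -
      have "j - i = 3" using \<open>j \<ge> i + 3\<close> that by auto
      then show ?thesis by simp
    qed
    ultimately show ?thesis by (cases "Suc (j - i) < 5") auto
  qed
qed

lemma next_position:
  assumes "v \<in> D" "v \<in> V"
  shows "\<exists>l>k. c l \<in> D \<and> (\<forall>p. k < p \<and> p < l \<longrightarrow> c p \<notin> D)"
proof -
  let ?P = "\<lambda>l. k < l \<and> c l \<in> D"
  obtain p where "Suc k \<le> p" "c p = v" using ex_position[OF assms(2)] by blast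
  then have "?P p" using assms(1) by auto
  then have "\<exists>l. ?P l" ..
  then have "?P (LEAST l. ?P l)" by (rule LeastI_ex)
  then show ?thesis using not_less_Least[of _ ?P] by blast
qed

lemma prev_position:
  assumes "k < q" "c k \<in> D"
  shows "\<exists>r. k \<le> r \<and> r < q \<and> c r \<in> D \<and> (\<forall>p. r < p \<and> p < q \<longrightarrow> c p \<notin> D)"
proof -
  define R where "R = {r \<in> {k..<q}. c r \<in> D}"
  have fin: "finite R" by (simp add: R_def)
  have "k \<in> R" using assms by (simp add: R_def)
  then have "Max R \<in> R" using Max_in[OF fin] by blast
  then have max: "k \<le> Max R" "Max R < q" "c (Max R) \<in> D" by (auto simp: R_def)
  have "c p \<notin> D" if "Max R < p" "p < q" for p
  proof -
    have "p \<notin> R" using that(1) Max_ge[OF fin] by (meson not_le)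
    then show ?thesis using that max by (simp add: R_def)
  qed
  then show ?thesis using max by blast
qed

text \<open>These spare positions later keep searches along the rim within one turn.\<close>

lemma two_more_positions:
  assumes A: "A \<in> inscribed V E" and "c i \<in> A"
  shows "\<exists>x y. i < x \<and> x < y \<and> y < i + n \<and> c x \<in> A \<and> c y \<in> A"
proof -
  have "finite A" using inscribed_sub_V[OF A] finite_V finite_subset by blast
  then have "2 \<le> card (A - {c i})" using inscribed_card_ge[OF A] assms(2) by simp
  then obtain T where "T \<subseteq> A - {c i}" "card T = 2" by (rule obtain_subset_with_card_n)
  then obtain u v where uv: "u \<in> A" "v \<in> A" "u \<noteq> c i" "v \<noteq> c i" "u \<noteq> v"
    by (auto simp: card_2_iff)
  obtain x y where x: "i \<le> x" "x < i + n" "c x = u" and y: "i \<le> y" "y < i + n" "c y = v"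
    using ex_position uv inscribed_sub_V[OF A] by (metis in_mono)
  have "i \<noteq> x" "i \<noteq> y" "x \<noteq> y" using uv x y by auto
  then have "x < y \<or> y < x" "i < x" "i < y" using x y by auto
  then show ?thesis using x y uv by blast
qed

text \<open>Passing from one position of \<open>A\<close> to the next raises the count by one and
  the position by an odd number.\<close>

lemma card_positions_parity:
  assumes A: "A \<in> inscribed V E" and "q \<le> r" "c q \<in> A" "c r \<in> A"
  shows "even (card {p \<in> {q..<r}. c p \<in> A} + q + r)"
  using assms(2,4)
proof (induction r rule: less_induct)
  case (less r)
  show ?case
  proof (cases "q = r")
    case False
    then obtain r' where r': "q \<le> r'" "r' < r" "c r' \<in> A" "\<forall>p. r' < p \<and> p < r \<longrightarrow> c p \<notin> A"
      using prev_position[of q r A] assms less.prems by auto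
    then have "{p \<in> {q..<r}. c p \<in> A} = insert r' {p \<in> {q..<r'}. c p \<in> A}"
      by auto (metis linorder_neqE_nat)
    then have "card {p \<in> {q..<r}. c p \<in> A} = Suc (card {p \<in> {q..<r'}. c p \<in> A})" by simp
    moreover have "even (card {p \<in> {q..<r'}. c p \<in> A} + q + r')" using less.IH[of r'] r' by simp
    moreover have "odd (r' + r)" using consecutive_odd[OF A, of r' r] r' less.prems by simp
    ultimately show ?thesis by auto
  qed simp
qed

text \<open>One full turn starting in \<open>A\<close> counts each vertex of \<open>A\<close> once
  and advances by the odd number \<open>n\<close>.\<close>

lemma inscribed_card_odd:
  assumes A: "A \<in> inscribed V E"
  shows "odd (card A)"
proof -
  obtain v where v: "v \<in> A" using inscribed_card_ge[OF A] by fastforce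
  then obtain q where q: "c q = v" using inscribed_sub_V[OF A] range_c by auto
  have "bij_betw c {p \<in> {q..<q + n}. c p \<in> A} A"
    unfolding bij_betw_def
  proof
    show "inj_on c {p \<in> {q..<q + n}. c p \<in> A}"
      by (rule inj_onI) (use c_eq_window[of _ _ q] in auto)
    show "c ` {p \<in> {q..<q + n}. c p \<in> A} = A"
    proof
      show "A \<subseteq> c ` {p \<in> {q..<q + n}. c p \<in> A}"
      proof
        fix a assume "a \<in> A"
        then obtain p where "q \<le> p" "p < q + n" "c p = a"
          using ex_position[of a q] inscribed_sub_V[OF A] by auto
        then show "a \<in> c ` {p \<in> {q..<q + n}. c p \<in> A}" using \<open>a \<in> A\<close> by auto
      qed
    qed auto
  qed
  then have "card {p \<in> {q..<q + n}. c p \<in> A} = card A" by (rule bij_betw_same_card)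
  then show ?thesis
    using card_positions_parity[OF A, of q "q + n"] q v odd_n by auto
qed

section \<open>Arcs between two cliques\<close>

text \<open>A directed arc in position order; its interior avoids only \<open>A\<close> and
  \<open>B\<close>, so it may meet other inscribed cliques.\<close>

definition transition :: "'a set \<Rightarrow> 'a set \<Rightarrow> nat \<Rightarrow> nat \<Rightarrow> bool" where
  "transition A B i j \<longleftrightarrow> i < j \<and> c i \<in> A \<and> c j \<in> B \<and> (\<forall>p. i < p \<and> p < j \<longrightarrow> c p \<notin> A \<union> B)"

text \<open>The arc, closed through \<open>v\<close> by a chord of \<open>A\<close> and a chord of
  \<open>B\<close>, is a hole on \<open>j - i + 2\<close> vertices; \<open>ends\<close> excludes a
  chord between the two ends of the arc.\<close>

lemma transition_common_vertex_even:
  assumes A: "A \<in> inscribed V E" and B: "B \<in> inscribed V E" and AB: "A \<inter> B = {v}"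
    and T: "transition A B i j" and ends: "c i \<notin> B" "c j \<notin> A"
  shows "even (i + j)"
proof -
  have ij: "i < j" "c i \<in> A" "c j \<in> B" and int: "\<And>p. i < p \<Longrightarrow> p < j \<Longrightarrow> c p \<notin> A \<and> c p \<notin> B"
    using T by (auto simp: transition_def)
  have v: "v \<in> A" "v \<in> B" "v \<in> V" using AB inscribed_sub_V[OF A] by auto
  obtain z where z: "i \<le> z" "z < i + n" "c z = v" using ex_position[OF v(3), of i] by auto
  have "z \<noteq> i" "z \<noteq> j" using z v ends by auto
  then have zj: "j < z" using int[of z] z v by force
  have "Suc j \<noteq> z" using inscribed_Suc[OF B, of j] ij z v by auto
  have "Suc z \<noteq> i + n" using inscribed_Suc[OF A, of z] ij z v c_add_n[of i] by metis
  \<comment> \<open>Otherwise \<open>v\<close> would form a triangle on a rim edge.\<close>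
  have "j \<noteq> Suc i"
  proof
    assume "j = Suc i"
    moreover have "{c i, v} \<in> E" "{c j, v} \<in> E"
      using inscribed_edge[OF A ij(2) v(1)] inscribed_edge[OF B ij(3) v(2)] ends v by auto
    ultimately show False using rim_triangle_free by blast
  qed
  let ?g = "\<lambda>x. if x \<le> j - i then i + x else z"
  have "even (j - i + 2)" if "5 \<le> j - i + 2"
  proof (rule no_odd_position_hole[OF A B, of _ ?g i])
    have inA: "c (?g x) \<in> A \<longleftrightarrow> x = 0 \<or> j - i < x" if "x < j - i + 2" for x
      using that ij int[of "i + x"] v z ends by (cases "x = 0"; cases "x = j - i"; cases "x < j - i") auto
    have inB: "c (?g x) \<in> B \<longleftrightarrow> x = j - i \<or> j - i < x" if "x < j - i + 2" for x
      using that ij int[of "i + x"] v z ends by (cases "x = 0"; cases "x = j - i"; cases "x < j - i") auto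
    fix x y assume xy: "x < y" "y < j - i + 2"
    show "((?g y = Suc (?g x) \<or> ?g x = Suc (?g y) \<or> Suc (?g y) = ?g x + n \<or> Suc (?g x) = ?g y + n) \<or>
        (c (?g x) \<in> A \<and> c (?g y) \<in> A) \<or> (c (?g x) \<in> B \<and> c (?g y) \<in> B))
        \<longleftrightarrow> y = Suc x \<or> (x = 0 \<and> Suc y = j - i + 2)"
      unfolding inA[OF less_trans[OF xy]] inA[OF xy(2)] inB[OF less_trans[OF xy]] inB[OF xy(2)]
      using xy zj z ij \<open>Suc j \<noteq> z\<close> \<open>Suc z \<noteq> i + n\<close> by auto
  qed (use that ij zj z in auto)
  moreover have "j - i = 2" if "\<not> 5 \<le> j - i + 2"
    using that ij \<open>j \<noteq> Suc i\<close> by auto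
  ultimately have "even (j - i)" by fastforce
  then show ?thesis using ij by auto
qed

section \<open>Disjoint cliques: comparing two arcs\<close>

context
  fixes A B :: "'a set"
  assumes A: "A \<in> inscribed V E" and B: "B \<in> inscribed V E" and disj: "A \<inter> B = {}"
begin

text \<open>Walk from \<open>i\<close> to \<open>j\<close>, take a chord of \<open>B\<close> to
  \<open>k\<close>, walk to \<open>l\<close> and return by a chord of \<open>A\<close>: a hole on
  \<open>(j - i) + (l - k) + 2\<close> vertices.\<close>

lemma antiparallel_even:
  assumes T: "transition A B i j" and T': "transition B A k l" and "j < k" "l < i + n"
  shows "even (i + j + k + l)"
proof -
  have ij: "i < j" "c i \<in> A" "c j \<in> B" and kl: "k < l" "c k \<in> B" "c l \<in> A"
    and int: "\<And>p. i < p \<Longrightarrow> p < j \<Longrightarrow> c p \<notin> A \<and> c p \<notin> B" "\<And>p. k < p \<Longrightarrow> p < l \<Longrightarrow> c p \<notin> A \<and> c p \<notin> B"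
    using T T' by (auto simp: transition_def)
  have ends: "c i \<notin> B" "c j \<notin> A" "c k \<notin> A" "c l \<notin> B" using ij kl disj by auto
  \<comment> \<open>Vertices of one clique are never rim neighbours, so no rim edge joins the two
    arcs.\<close>
  have jk: "Suc j < k" using inscribed_Suc[OF B, of j] ij kl \<open>j < k\<close> by (metis Suc_lessI)
  have li: "Suc l < i + n" using inscribed_Suc[OF A, of l] ij kl \<open>l < i + n\<close> c_add_n[of i] by (metis Suc_lessI)
  define d where "d = j - i"
  define e where "e = l - k"
  have de: "j = i + d" "l = k + e" "0 < d" "0 < e" using ij kl by (auto simp: d_def e_def)
  \<comment> \<open>Indices 0 to \<open>d\<close> run along the first arc; index
    \<open>Suc d\<close> jumps to \<open>k\<close>.\<close>
  let ?g = "\<lambda>x. if x \<le> d then i + x else k + (x - Suc d)"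
  have "even (d + e + 2)" if "5 \<le> d + e + 2"
  proof (rule no_odd_position_hole[OF A B, of _ ?g i])
    have labels: "(c (?g x) \<in> A \<longleftrightarrow> x = 0 \<or> x = Suc (d + e)) \<and> (c (?g x) \<in> B \<longleftrightarrow> x = d \<or> x = Suc d)"
      if "x < d + e + 2" for x
    proof -
      have "x < Suc (Suc (d + e))" using that by simp
      then consider "x = 0" | "x = d" | "x = Suc d" | "x = Suc (d + e)" | "0 < x" "x < d" | "Suc d < x" "x < Suc (d + e)"
        by (metis gr_zeroI less_SucE Suc_lessI linorder_neqE_nat)
      then show ?thesis
        by cases (use de ij kl ends int(1)[of "i + x"] int(2)[of "k + (x - Suc d)"] in auto)
    qed
    note inA = labels[THEN conjunct1] and inB = labels[THEN conjunct2]
    fix x y assume xy: "x < y" "y < d + e + 2"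
    have no_wrap: "Suc a \<noteq> b + n" if "a \<le> l" "i \<le> b" for a b
      using that li by linarith
    have bnd: "i \<le> ?g z \<and> ?g z \<le> l" if "z < d + e + 2" for z
      using that jk de by auto
    then have wrap: "Suc (?g y) \<noteq> ?g x + n" "Suc (?g x) \<noteq> ?g y + n"
      using bnd[of x] bnd[of y] no_wrap xy by (meson less_trans)+
    \<comment> \<open>The rim supplies all successive pairs except the jump after \<open>d\<close>,
      which is the chord of \<open>B\<close>; the closing chord comes from \<open>A\<close>.\<close>
    have rim: "(?g y = Suc (?g x) \<or> ?g x = Suc (?g y) \<or> Suc (?g y) = ?g x + n \<or> Suc (?g x) = ?g y + n)
        \<longleftrightarrow> y = Suc x \<and> x \<noteq> d"
    proof (cases "y \<le> d")
      case True
      then show ?thesis using xy wrap by auto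
    next
      case False
      then obtain y' where y': "y = Suc d + y'" by (metis add.commute not_less_eq_eq le_Suc_ex)
      show ?thesis
      proof (cases "x \<le> d")
        case True
        then show ?thesis using jk de xy y' wrap by auto
      next
        case False
        then obtain x' where "x = Suc d + x'" by (metis add.commute not_less_eq_eq le_Suc_ex)
        then show ?thesis using xy y' wrap by auto
      qed
    qed
    show "((?g y = Suc (?g x) \<or> ?g x = Suc (?g y) \<or> Suc (?g y) = ?g x + n \<or> Suc (?g x) = ?g y + n) \<or>
        (c (?g x) \<in> A \<and> c (?g y) \<in> A) \<or> (c (?g x) \<in> B \<and> c (?g y) \<in> B))
        \<longleftrightarrow> y = Suc x \<or> (x = 0 \<and> Suc y = d + e + 2)"
      unfolding inA[OF less_trans[OF xy]] inA[OF xy(2)] inB[OF less_trans[OF xy]] inB[OF xy(2)]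
      unfolding rim using xy de by auto
  qed (use that jk li de in auto)
  \<comment> \<open>Two single edges close to a 4-cycle, where the parity is immediate.\<close>
  moreover have "d + e = 2" if "\<not> 5 \<le> d + e + 2"
    using that de by auto
  ultimately have "even (d + e)" by fastforce
  then show ?thesis using de by auto
qed

text \<open>The second arc is traversed backwards. The facing ends \<open>j\<close>,
  \<open>k\<close> and \<open>l\<close>, \<open>i + n\<close> carry different labels and could be
  rim neighbours, so the gaps are hypotheses here.\<close>

lemma parallel_even:
  assumes T: "transition A B i j" and T': "transition A B k l" and jk: "Suc j < k" and li: "Suc l < i + n"
  shows "even (i + j + k + l)"
proof -
  have ij: "i < j" "c i \<in> A" "c j \<in> B" and kl: "k < l" "c k \<in> A" "c l \<in> B"
    and int: "\<And>p. i < p \<Longrightarrow> p < j \<Longrightarrow> c p \<notin> A \<and> c p \<notin> B" "\<And>p. k < p \<Longrightarrow> p < l \<Longrightarrow> c p \<notin> A \<and> c p \<notin> B"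
    using T T' by (auto simp: transition_def)
  have ends: "c i \<notin> B" "c j \<notin> A" "c k \<notin> B" "c l \<notin> A" using ij kl disj by auto
  define d where "d = j - i"
  define e where "e = l - k"
  have de: "j = i + d" "l = k + e" "0 < d" "0 < e" using ij kl by (auto simp: d_def e_def)
  \<comment> \<open>Index \<open>Suc d\<close> lands on \<open>l = k + e\<close>, and the last index
    \<open>Suc (d + e)\<close> on \<open>k\<close>.\<close>
  let ?g = "\<lambda>x. if x \<le> d then i + x else k + (Suc (d + e) - x)"
  have "even (d + e + 2)" if "5 \<le> d + e + 2"
  proof (rule no_odd_position_hole[OF A B, of _ ?g i])
    have labels: "(c (?g x) \<in> A \<longleftrightarrow> x = 0 \<or> x = Suc (d + e)) \<and> (c (?g x) \<in> B \<longleftrightarrow> x = d \<or> x = Suc d)"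
      if "x < d + e + 2" for x
    proof -
      have "x < Suc (Suc (d + e))" using that by simp
      then consider "x = 0" | "x = d" | "x = Suc d" | "x = Suc (d + e)" | "0 < x" "x < d" | "Suc d < x" "x < Suc (d + e)"
        by (metis gr_zeroI less_SucE Suc_lessI linorder_neqE_nat)
      then show ?thesis
        by cases (use de ij kl ends int(1)[of "i + x"] int(2)[of "k + (Suc (d + e) - x)"] in auto)
    qed
    note inA = labels[THEN conjunct1] and inB = labels[THEN conjunct2]
    fix x y assume xy: "x < y" "y < d + e + 2"
    have no_wrap: "Suc a \<noteq> b + n" if "a \<le> l" "i \<le> b" for a b
      using that li by linarith
    have bnd: "i \<le> ?g z \<and> ?g z \<le> l" if "z < d + e + 2" for z
      using that jk de by auto
    then have wrap: "Suc (?g y) \<noteq> ?g x + n" "Suc (?g x) \<noteq> ?g y + n"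
      using bnd[of x] bnd[of y] no_wrap xy by (meson less_trans)+
    have rim: "(?g y = Suc (?g x) \<or> ?g x = Suc (?g y) \<or> Suc (?g y) = ?g x + n \<or> Suc (?g x) = ?g y + n)
        \<longleftrightarrow> y = Suc x \<and> x \<noteq> d"
    proof (cases "y \<le> d")
      case True
      then show ?thesis using xy wrap by auto
    next
      case False
      then obtain y' where y': "y = Suc d + y'" by (metis add.commute not_less_eq_eq le_Suc_ex)
      show ?thesis
      proof (cases "x \<le> d")
        case True
        then show ?thesis using jk de xy y' wrap by auto
      next
        case False
        then obtain x' where "x = Suc d + x'" by (metis add.commute not_less_eq_eq le_Suc_ex)
        then show ?thesis using xy y' wrap by auto
      qed
    qed
    show "((?g y = Suc (?g x) \<or> ?g x = Suc (?g y) \<or> Suc (?g y) = ?g x + n \<or> Suc (?g x) = ?g y + n) \<or>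
        (c (?g x) \<in> A \<and> c (?g y) \<in> A) \<or> (c (?g x) \<in> B \<and> c (?g y) \<in> B))
        \<longleftrightarrow> y = Suc x \<or> (x = 0 \<and> Suc y = d + e + 2)"
      unfolding inA[OF less_trans[OF xy]] inA[OF xy(2)] inB[OF less_trans[OF xy]] inB[OF xy(2)]
      unfolding rim using xy de by auto
  qed (use that jk li de in auto)
  moreover have "d + e = 2" if "\<not> 5 \<le> d + e + 2"
    using that de by auto
  ultimately have "even (d + e)" by fastforce
  then show ?thesis using de by auto
qed

text \<open>Neither the arcs nor the stretch between them meets \<open>A\<close> inside, so
  \<open>i\<close> and \<open>l\<close> are consecutive positions of \<open>A\<close>.\<close>

lemma transitions_consecutive_odd:
  assumes "transition A B i j" "transition B A k l" "j \<le> k" "\<And>p. j < p \<Longrightarrow> p < k \<Longrightarrow> c p \<notin> A"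
  shows "odd (i + l)"
proof -
  have "c p \<notin> A" if "i < p" "p < l" for p
  proof -
    consider "p < j" | "p = j" | "j < p" "p < k" | "p = k" | "k < p" by linarith
    then show ?thesis
      by cases (use assms that disj in \<open>auto simp: transition_def\<close>)
  qed
  then have "odd (l - i)"
    using consecutive_odd[OF A, of i l] assms by (auto simp: transition_def)
  then show ?thesis using assms by (auto simp: transition_def)
qed

text \<open>Take the next position \<open>l\<close> of \<open>A\<close> after \<open>j\<close>, then
  step back to the last labelled position \<open>r\<close>, which must lie in \<open>B\<close>.
  Another vertex of \<open>A\<close> keeps \<open>l\<close> below \<open>i + n\<close>.\<close>

lemma next_transition:
  assumes T: "transition A B i j"
  shows "\<exists>r l. j \<le> r \<and> transition B A r l \<and> l < i + n \<and> (\<forall>p. i < p \<and> p < l \<longrightarrow> c p \<notin> A)"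
proof -
  have ij: "i < j" "c i \<in> A" "c j \<in> B" and int: "\<And>p. i < p \<Longrightarrow> p < j \<Longrightarrow> c p \<notin> A"
    using T by (auto simp: transition_def)
  have jA: "c j \<notin> A" using ij disj by auto
  obtain x where x: "i < x" "x < i + n" "c x \<in> A" using two_more_positions[OF A ij(2)] by (meson less_trans)
  obtain l where l: "j < l" "c l \<in> A" "\<forall>p. j < p \<and> p < l \<longrightarrow> c p \<notin> A"
    using next_position[OF ij(2) c_in_V, of j] by auto
  have noA: "c p \<notin> A" if "i < p" "p < l" for p
    using that int[of p] l(3) jA by (metis linorder_neqE_nat)
  then have "l \<le> x" using x by (meson not_le)
  obtain r where r: "j \<le> r" "r < l" "c r \<in> A \<union> B" "\<forall>p. r < p \<and> p < l \<longrightarrow> c p \<notin> A \<union> B"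
    using prev_position[OF l(1), of "A \<union> B"] ij by auto
  have "c r \<in> B" using noA[of r] r ij by auto
  then have "transition B A r l" using r l by (auto simp: transition_def)
  then show ?thesis using r noA \<open>l \<le> x\<close> x by (meson le_less_trans)
qed

end

section \<open>Disjoint cliques: runs of equal labels around the rim\<close>

text \<open>Sharing \<open>j\<close> makes it a run of one vertex. If the run of \<open>A\<close>
  from \<open>k\<close> ended later, at \<open>r\<close>, then the arc from \<open>r\<close> to
  \<open>q\<close> would be antiparallel to that from \<open>j\<close> to \<open>k\<close> and
  parallel to that from \<open>i\<close> to \<open>j\<close>. This makes \<open>i + k\<close> even,
  although \<open>i\<close> and \<open>k\<close> are consecutive in \<open>A\<close>.\<close>

lemma singleton_run_step:
  assumes A: "A \<in> inscribed V E" and B: "B \<in> inscribed V E" and disj: "A \<inter> B = {}"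
    and T: "transition A B i j" and T': "transition B A j k"
  shows "\<exists>l. transition A B k l"
proof -
  have disj': "B \<inter> A = {}" using disj by auto
  obtain r q where rq: "k \<le> r" "transition A B r q" "q < j + n" "\<forall>p. j < p \<and> p < q \<longrightarrow> c p \<notin> B"
    using next_transition[OF B A disj' T'] by auto
  have "c j \<in> B" using T by (auto simp: transition_def)
  then obtain x y where xy: "j < x" "x < y" "y < j + n" "c x \<in> B" "c y \<in> B"
    using two_more_positions[OF B] by blast
  have "q < y" using rq xy by (meson not_le le_less_trans)
  \<comment> \<open>The arc from \<open>i\<close> to \<open>j\<close>, shifted by \<open>n\<close>,
    has no vertex of \<open>B\<close> before its end \<open>j + n\<close>, so \<open>y\<close>
    precedes it. This gives the gap needed for \<open>parallel_even\<close>.\<close>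
  have "y < i + n"
  proof (rule ccontr)
    assume "\<not> y < i + n"
    then have "i + n \<le> y" by simp
    then obtain z where z: "y = i + n + z" using le_Suc_ex by blast
    then have y: "y = (i + z) + n" by simp
    then have "c (i + z) \<in> B" "i + z < j" using xy by auto
    then show False using T disj by (cases "z = 0") (auto simp: transition_def)
  qed
  show ?thesis
  proof (cases "r = k")
    case False
    then have "k < r" using rq by simp
    have "j < k" "k < r" using T' \<open>k < r\<close> by (auto simp: transition_def)
    have "even (j + k + r + q)"
      using antiparallel_even[OF B A disj' T' rq(2)] \<open>k < r\<close> rq by auto
    moreover have "even (i + j + r + q)"
      using parallel_even[OF A B disj T rq(2)] \<open>j < k\<close> \<open>k < r\<close> \<open>q < y\<close> \<open>y < i + n\<close> by auto
    moreover have "odd (i + k)"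
      using transitions_consecutive_odd[OF A B disj T T'] by auto
    ultimately show ?thesis by auto
  qed (use rq in auto)
qed

text \<open>Propagation yields positions \<open>j\<close>, \<open>k\<close>, \<open>k1\<close>,
  \<open>k2\<close>, \<open>k3\<close> alternating between \<open>B\<close> and \<open>A\<close>.
  Consecutive distances make \<open>j + k3\<close> even and \<open>k + k2\<close> odd, against
  \<open>antiparallel_even\<close> for the first and last arcs.\<close>

lemma no_singleton_run:
  assumes A: "A \<in> inscribed V E" and B: "B \<in> inscribed V E" and disj: "A \<inter> B = {}"
    and T: "transition A B i j" and T1: "transition B A j k"
  shows False
proof -
  have disj': "B \<inter> A = {}" using disj by auto
  obtain k1 where T2: "transition A B k k1" using singleton_run_step[OF A B disj T T1] by auto
  obtain k2 where T3: "transition B A k1 k2" using singleton_run_step[OF B A disj' T1 T2] by auto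
  obtain k3 where T4: "transition A B k2 k3" using singleton_run_step[OF A B disj T2 T3] by auto
  have "c j \<in> B" using T by (auto simp: transition_def)
  then obtain x y where xy: "j < x" "x < y" "y < j + n" "c x \<in> B" "c y \<in> B"
    using two_more_positions[OF B] by blast
  \<comment> \<open>Two further vertices of \<open>B\<close> bound \<open>k1\<close> and
    \<open>k3\<close>, so the five positions fit into one turn.\<close>
  have k1x: "k1 \<le> x"
  proof (rule ccontr)
    assume "\<not> k1 \<le> x"
    then consider "x < k" | "x = k" | "k < x" "x < k1" by linarith
    then show False by cases (use T1 T2 xy disj in \<open>auto simp: transition_def\<close>)
  qed
  have "k3 \<le> y"
  proof (rule ccontr)
    assume "\<not> k3 \<le> y"
    then consider "y < k2" | "y = k2" | "k2 < y" "y < k3" by linarith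
    then show False by cases (use T3 T4 xy k1x disj in \<open>auto simp: transition_def\<close>)
  qed
  have "even (j + k + k2 + k3)"
    using antiparallel_even[OF B A disj' T1 T4] \<open>k3 \<le> y\<close> xy T2 T3 by (auto simp: transition_def)
  moreover have "odd (j + k1)" "odd (k + k2)" "odd (k1 + k3)"
    using transitions_consecutive_odd[OF A B disj T2 T3] transitions_consecutive_odd[OF B A disj' T1 T2]
      transitions_consecutive_odd[OF B A disj' T3 T4] by auto
  ultimately show False by auto
qed

text \<open>Applied to a run start and its shift by the odd period \<open>n\<close>, this is contradictory.\<close>
lemma run_starts_same_parity:
  assumes A: "A \<in> inscribed V E" and B: "B \<in> inscribed V E" and disj: "A \<inter> B = {}"
    and T': "transition A B i' j'"
  shows "transition A B i j \<Longrightarrow> j \<le> j' \<Longrightarrow> even (j + j')"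
proof (induction "j' - j" arbitrary: i j rule: less_induct)
  case less
  note T = less.prems(1)
  have disj': "B \<inter> A = {}" using disj by auto
  show ?case
  proof (cases "j = j'")
    case False
    then have "j < j'" using less.prems by simp
    obtain r l where rl: "j \<le> r" "transition B A r l" "l < i + n" "\<forall>p. i < p \<and> p < l \<longrightarrow> c p \<notin> A"
      using next_transition[OF A B disj T] by auto
    \<comment> \<open>The run of \<open>B\<close> at \<open>j\<close> has at least two vertices, so
      \<open>antiparallel_even\<close> applies.\<close>
    have "j \<noteq> r" using no_singleton_run[OF A B disj T] rl by auto
    obtain s q where sq: "l \<le> s" "transition A B s q" "q < r + n" "\<forall>p. r < p \<and> p < q \<longrightarrow> c p \<notin> B"
      using next_transition[OF B A disj' rl(2)] by auto
    have "even (i + j + r + l)"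
      using antiparallel_even[OF A B disj T rl(2)] rl \<open>j \<noteq> r\<close> by simp
    moreover have "odd (i + l)"
      using transitions_consecutive_odd[OF A B disj T rl(2)] rl T by (auto simp: transition_def)
    moreover have "odd (r + q)"
      using transitions_consecutive_odd[OF B A disj' rl(2) sq(2)] sq rl by (auto simp: transition_def)
    ultimately have "even (j + q)" by auto
    have "q \<le> j'"
    proof (rule ccontr)
      assume "\<not> q \<le> j'"
      then consider "j' \<le> r" | "r < j'" "j' < q" by linarith
      then show False
      proof cases
        case 1
        have i': "i' < j'" "c i' \<in> A" using T' by (auto simp: transition_def)
        have ij: "i < j" "c j \<in> B" using T by (auto simp: transition_def)
        have "\<not> i < i'" using rl i' 1 by (auto simp: transition_def)
        then show False using T' ij \<open>j < j'\<close> by (auto simp: transition_def)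
      qed (use sq T' in \<open>auto simp: transition_def\<close>)
    qed
    moreover have "j < q" using rl sq by (auto simp: transition_def)
    ultimately have "even (q + j')" using less.hyps[of q s] sq by auto
    then show ?thesis using \<open>even (j + q)\<close> by auto
  qed simp
qed

lemma inscribed_not_disjoint:
  assumes A: "A \<in> inscribed V E" and B: "B \<in> inscribed V E"
  shows "A \<inter> B \<noteq> {}"
proof
  assume disj: "A \<inter> B = {}"
  obtain a b where ab: "a \<in> A" "b \<in> B" using inscribed_card_ge[OF A] inscribed_card_ge[OF B] by fastforce
  obtain i where i: "c i = a" using ab inscribed_sub_V[OF A] range_c by auto
  obtain j where j: "i < j" "c j \<in> B" "\<forall>p. i < p \<and> p < j \<longrightarrow> c p \<notin> B"
    using next_position[of b B i] ab inscribed_sub_V[OF B] by auto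
  obtain r where r: "i \<le> r" "r < j" "c r \<in> A" "\<forall>p. r < p \<and> p < j \<longrightarrow> c p \<notin> A"
    using prev_position[OF j(1), of A] i ab by auto
  have T: "transition A B r j" using r j by (auto simp: transition_def)
  have "transition A B (r + n) (j + n)"
    unfolding transition_def
  proof (intro conjI allI impI)
    fix p assume p: "r + n < p \<and> p < j + n"
    then have "n \<le> p" by simp
    then obtain z where "p = z + n" by (metis le_add_diff_inverse2)
    then show "c p \<notin> A \<union> B" using T p by (auto simp: transition_def)
  qed (use T in \<open>auto simp: transition_def\<close>)
  then have "even (j + (j + n))" by (rule run_starts_same_parity[OF A B disj _ T]) simp
  then show False using odd_n by simp
qed

lemma rim_neighbour:
  assumes "{c (Suc p), y} \<in> rim V E"
  shows "y = c p \<or> y = c (Suc (Suc p))"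
proof -
  have e: "{c (Suc p), y} \<in> E" using assms rim_sub_E by auto
  then have "y \<in> V" "y \<noteq> c (Suc p)" using edge_sub edge_neq by blast+
  then obtain q where q: "p \<le> q" "q < p + n" "c q = y" using ex_position[of y p] by auto
  have "q \<noteq> Suc p" using q \<open>y \<noteq> c (Suc p)\<close> by auto
  show ?thesis
  proof (cases "q = p")
    case False
    then have "Suc p < q" using q \<open>q \<noteq> Suc p\<close> by auto
    then show ?thesis using rim_iff[of "Suc p" q] assms q by auto
  qed (use q in auto)
qed

lemma rim_subpath_positions:
  assumes P: "rim_subpath V E P"
  shows "\<exists>i. (\<forall>x < length P. P ! x = c (i + x)) \<or> (\<forall>x < length P. P ! x = c (i + (length P - 1 - x)))"
proof -
  have dist: "distinct P" and len: "2 \<le> length P"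
    and edge: "\<And>x. Suc x < length P \<Longrightarrow> {P ! x, P ! Suc x} \<in> rim V E"
    using P by (auto simp: rim_subpath_def)
  have "P ! 0 \<in> V" using edge[of 0] len rim_sub_E edge_sub by fastforce
  then obtain s where s: "Suc (length P) \<le> s" "c s = P ! 0" using ex_position[of "P ! 0" "Suc (length P)"] by auto
  then obtain t where t: "s = Suc t" by (cases s) auto
  have "{c (Suc t), P ! 1} \<in> rim V E" using edge[of 0] s t len by simp
  then consider "P ! 1 = c t" | "P ! 1 = c (Suc (Suc t))" using rim_neighbour by blast
  then show ?thesis
  proof cases
    case 1
    have "P ! x = c (s - x) \<and> P ! Suc x = c (s - Suc x)" if "Suc x < length P" for x
      using that
    proof (induction x)
      case (Suc x)
      then have IH: "P ! x = c (s - x)" "P ! Suc x = c (s - Suc x)" by auto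
      define u where "u = s - Suc (Suc x)"
      have u: "s - x = Suc (Suc u)" "s - Suc x = Suc u" using Suc.prems s by (auto simp: u_def)
      have "{c (Suc u), P ! Suc (Suc x)} \<in> rim V E" using edge[of "Suc x"] Suc.prems IH u by simp
      moreover have "P ! Suc (Suc x) \<noteq> P ! x" using dist Suc.prems by (simp add: nth_eq_iff_index_eq)
      ultimately have "P ! Suc (Suc x) = c u" using rim_neighbour[of u] IH u by auto
      then show ?case using IH by (simp add: u_def)
    qed (use 1 s t in auto)
    then have "P ! x = c (s - x)" if "x < length P" for x
      using that len by (cases x) auto
    then show ?thesis using s by (intro exI[of _ "Suc s - length P"] disjI2) auto
  next
    case 2
    have "P ! x = c (s + x) \<and> P ! Suc x = c (s + Suc x)" if "Suc x < length P" for x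
      using that
    proof (induction x)
      case (Suc x)
      then have IH: "P ! x = c (s + x)" "P ! Suc x = c (Suc (s + x))" by auto
      have "{c (Suc (s + x)), P ! Suc (Suc x)} \<in> rim V E" using edge[of "Suc x"] Suc.prems IH by simp
      moreover have "P ! Suc (Suc x) \<noteq> P ! x" using dist Suc.prems by (simp add: nth_eq_iff_index_eq)
      ultimately show ?case using rim_neighbour[of "s + x"] IH by auto
    qed (use 2 s t in auto)
    then have "P ! x = c (s + x)" if "x < length P" for x
      using that len by (cases x) auto
    then show ?thesis by auto
  qed
qed

lemma AB_path_positions:
  assumes P: "AB_path V E A B P"
  shows "\<exists>i j. j + 1 = i + length P \<and> i < j \<and> (c i \<in> A \<and> c j \<in> B \<or> c i \<in> B \<and> c j \<in> A) \<and>
    (\<forall>p. i < p \<and> p < j \<longrightarrow> c p \<notin> \<Union> (inscribed V E))"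
proof -
  have len: "2 \<le> length P" and sub: "rim_subpath V E P"
    and ends: "(hd P \<in> A \<and> last P \<in> B) \<or> (hd P \<in> B \<and> last P \<in> A)"
    and int: "\<forall>v \<in> set (butlast (tl P)). v \<notin> \<Union> (inscribed V E)"
    using P by (auto simp: AB_path_def rim_subpath_def)
  have "P \<noteq> []" using len by auto
  have hl: "hd P = P ! 0" "last P = P ! (length P - 1)"
    using len by (cases P; simp add: hd_conv_nth last_conv_nth)+
  have int': "P ! x \<notin> \<Union> (inscribed V E)" if "0 < x" "x < length P - 1" for x
  proof -
    have "butlast (tl P) ! (x - 1) = P ! x" "x - 1 < length (butlast (tl P))"
      using that by (auto simp: nth_butlast nth_tl)
    then have "P ! x \<in> set (butlast (tl P))" by (metis nth_mem)
    then show ?thesis using int by auto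
  qed
  obtain i where i: "(\<forall>x < length P. P ! x = c (i + x)) \<or> (\<forall>x < length P. P ! x = c (i + (length P - 1 - x)))"
    using rim_subpath_positions[OF sub] by auto
  let ?j = "i + (length P - 1)"
  from i show ?thesis
  proof
    assume *: "\<forall>x < length P. P ! x = c (i + x)"
    then have "c p \<notin> \<Union> (inscribed V E)" if "i < p" "p < ?j" for p
      using int'[of "p - i"] that by auto
    moreover have "hd P = c i" "last P = c ?j" using *[rule_format, of 0] *[rule_format, of "length P - 1"] hl len \<open>P \<noteq> []\<close> by auto
    ultimately show ?thesis using ends len by (intro exI[of _ i] exI[of _ ?j]) auto
  next
    assume *: "\<forall>x < length P. P ! x = c (i + (length P - 1 - x))"
    then have "c p \<notin> \<Union> (inscribed V E)" if "i < p" "p < ?j" for p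
      using int'[of "?j - p"] that by auto
    moreover have "hd P = c ?j" "last P = c i" using *[rule_format, of 0] *[rule_format, of "length P - 1"] hl len \<open>P \<noteq> []\<close> by auto
    ultimately show ?thesis using ends len by (intro exI[of _ i] exI[of _ ?j]) auto
  qed
qed

lemma N1_holds: "N1 V E"
  unfolding N1_def
proof (intro ballI allI impI)
  fix A P assume A: "A \<in> inscribed V E" and P: "AB_path V E A A P"
  obtain i j where ij: "j + 1 = i + length P" "i < j" "c i \<in> A" "c j \<in> A"
    "\<forall>p. i < p \<and> p < j \<longrightarrow> c p \<notin> \<Union> (inscribed V E)"
    using AB_path_positions[OF P] by auto
  then have "odd (j - i)" using consecutive_odd[OF A, of i j] A by auto
  moreover have "j \<noteq> Suc i" using inscribed_Suc[OF A, of i] ij by auto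
  moreover obtain d where d: "j = i + d" using ij(2) by (metis less_imp_add_positive)
  moreover have "length P = Suc d" using ij(1) d by auto
  ultimately have "odd d" "d \<noteq> 1" "length P = Suc d" by auto
  then show "even (length P) \<and> 4 \<le> length P" by (cases "d = 0 \<or> d = 2") auto
qed

lemma inscribed_common_vertex: "\<exists>\<xi>. N3 V E \<xi>"
proof (cases "\<exists>A B. A \<in> inscribed V E \<and> B \<in> inscribed V E \<and> A \<noteq> B")
  case True
  then obtain A B where AB: "A \<in> inscribed V E" "B \<in> inscribed V E" "A \<noteq> B" by auto
  then obtain x where x: "x \<in> A" "x \<in> B" using inscribed_not_disjoint by blast
  have all: "x \<in> C" if C: "C \<in> inscribed V E" for C
  proof -
    obtain y where "y \<in> A" "y \<in> C" using inscribed_not_disjoint[OF AB(1) C] by auto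
    moreover obtain z where "z \<in> B" "z \<in> C" using inscribed_not_disjoint[OF AB(2) C] by auto
    ultimately show ?thesis using inscribed_helly[OF AB(1,2) C x _ _ _ _ AB(3)] by blast
  qed
  have "C \<inter> D = {x}" if "C \<in> inscribed V E" "D \<in> inscribed V E" "C \<noteq> D" for C D
    using inscribed_Int[OF that] all that by blast
  then show ?thesis unfolding N3_def using all x inscribed_sub_V AB by (intro exI[of _ x]) blast
next
  case False
  show ?thesis
  proof (cases "inscribed V E = {}")
    case True
    then show ?thesis using c_in_V by (auto simp: N3_def simp del: c_in_V intro: exI[of _ "c 0"])
  next
    case nonempty: False
    then obtain A where A: "A \<in> inscribed V E" by auto
    then obtain x where "x \<in> A" using inscribed_card_ge by fastforce
    then show ?thesis using A False inscribed_sub_V[OF A] unfolding N3_def by (intro exI[of _ x]) blast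
  qed
qed

lemma N3_imp_N4:
  assumes "N3 V E \<xi>"
  shows "N4 V E \<xi>"
  unfolding N4_def
proof (intro ballI allI impI)
  fix A P assume A: "A \<in> inscribed V E" and "AB_path V E A {\<xi>} P"
  then have "AB_path V E A A P" using assms by (auto simp: AB_path_def N3_def)
  then show "even (length P)" using N1_holds A by (auto simp: N1_def)
qed

lemma N5_holds: "N5 V E"
  unfolding N5_def
proof (intro ballI allI impI)
  fix A B P
  assume A: "A \<in> inscribed V E" and B: "B \<in> inscribed V E" and "A \<noteq> B"
    and P: "AB_path V E (A - B) (B - A) P"
  obtain v where v: "A \<inter> B = {v}" "B \<inter> A = {v}"
    using inscribed_common_vertex A B \<open>A \<noteq> B\<close> unfolding N3_def by metis
  obtain i j where ij: "j + 1 = i + length P" "i < j"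
    "c i \<in> A - B \<and> c j \<in> B - A \<or> c i \<in> B - A \<and> c j \<in> A - B"
    "\<forall>p. i < p \<and> p < j \<longrightarrow> c p \<notin> \<Union> (inscribed V E)"
    using AB_path_positions[OF P] by auto
  then have "transition A B i j \<or> transition B A i j"
    using A B by (auto simp: transition_def)
  then have "even (i + j)"
    using transition_common_vertex_even[OF A B v(1), of i j] transition_common_vertex_even[OF B A v(2), of i j] ij
    by (auto simp: transition_def)
  then have "odd (i + (i + length P))" unfolding ij(1)[symmetric] by simp
  then show "odd (length P)" by presburger
qed

end

theorem theorem2:
  fixes V :: "'a set" and E :: "'a set set"
  assumes "multisun V E" and "HOH_free V E"
  shows "N_conditions V E"
proof -
  obtain cs where cs: "distinct cs" "set cs = V" "3 \<le> length cs" "cycle_edges cs = rim V E"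
    using assms(1) by (auto simp: multisun_def is_hamiltonian_cycle_edges_def)
  define n where "n = length cs"
  define c where "c i = cs ! (i mod n)" for i
  have n: "3 \<le> n" "n > 0" using cs by (auto simp: n_def)
  interpret hoh_free_multisun V E n c
  proof
    show "odd n" using assms(1) cs by (auto simp: multisun_def n_def distinct_card)
    show "c i = c j \<longleftrightarrow> i mod n = j mod n" for i j
      using cs n by (simp add: c_def n_def nth_eq_iff_index_eq)
    have "c i = cs ! i" if "i < n" for i using that by (simp add: c_def)
    then have "v \<in> range c" if "v \<in> V" for v
      using that cs by (auto simp: n_def in_set_conv_nth) (metis rangeI)
    moreover have "c i \<in> V" for i using cs n by (auto simp: c_def n_def)
    ultimately show "range c = V" by auto
    show "rim V E = {{c i, c (Suc i)} | i. True}"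
    proof
      show "rim V E \<subseteq> {{c i, c (Suc i)} | i. True}"
      proof
        fix e assume "e \<in> rim V E"
        then obtain i where "i < n" "e = {cs ! i, cs ! ((i + 1) mod n)}"
          using cs(4) by (auto simp: cycle_edges_def n_def)
        then have "e = {c i, c (Suc i)}" by (simp add: c_def)
        then show "e \<in> {{c i, c (Suc i)} | i. True}" by auto
      qed
      have "{c i, c (Suc i)} \<in> cycle_edges cs" for i
        unfolding cycle_edges_def using n by (auto simp: c_def n_def mod_Suc_eq intro!: exI[of _ "i mod n"])
      then show "{{c i, c (Suc i)} | i. True} \<subseteq> rim V E" using cs(4) by auto
    qed
  qed (use assms n in auto)
  show ?thesis
    unfolding N_conditions_def N2_def
    using N1_holds N5_holds inscribed_common_vertex N3_imp_N4 inscribed_card_odd by blast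
qed

end
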